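(* There is an absolute constant $c>0$ such that for every field $\mathbb{F}$ (of arbitrary characteristic) and all integers $1 \le d \le n$, every algebraic formula over $\mathbb{F}$ computing the elementary symmetric polynomial $e_d^n \in \mathbb{F}[x_1,\ldots,x_n]$ has size at least $c\, d(n-d)$. (That is, any algebraic formula computing $e_d^n$ has size $\Omega(d(n-d))$.)
   Context: For $d \le n$, $e_d^n = \sum_{S \subseteq [n],\, |S|=d} \prod_{i \in S} x_i$ is the elementary symmetric polynomial of degree $d$ in $n$ variables. An algebraic formula over $\mathbb{F}$ is a rooted tree whose leaves are labeled by variables $x_1,\ldots,x_n$ or constants from $\mathbb{F}$ and whose internal nodes are labeled by $+$ or $\times$; each node computes a polynomial in the natural way, and the formula computes the polynomial computed at its root. The size of a formula is the number of its leaves whose label is not a constant (this is linearly related to the usual notion of size). *)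

theory Defs
  imports Complex_Main "HOL-Library.Poly_Mapping"
begin

text \<open>
  Multivariate polynomials are finitely supported maps from monomials to coefficients, where a
  monomial is a finitely supported map from variable indices to exponents; multiplication is
  the convolution product of \<^theory>\<open>HOL-Library.Poly_Mapping\<close>.
  The ring \<open>F[x\<^sub>1, \<dots>, x\<^sub>n]\<close> sits inside as the polynomials involving only indices in \<open>{1..n}\<close>.
\<close>

type_synonym 'a mpoly = "(nat \<Rightarrow>\<^sub>0 nat) \<Rightarrow>\<^sub>0 'a"

definition mpoly_var :: "nat \<Rightarrow> 'a::comm_ring_1 mpoly" where
  "mpoly_var i = Poly_Mapping.single (Poly_Mapping.single i 1) 1"

definition mpoly_const :: "'a::comm_ring_1 \<Rightarrow> 'a mpoly" where
  "mpoly_const a = Poly_Mapping.single 0 a"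

definition elem_sym :: "nat \<Rightarrow> nat \<Rightarrow> 'a::comm_ring_1 mpoly" where
  "elem_sym n d = (\<Sum>S | S \<subseteq> {1..n} \<and> card S = d. \<Prod>i\<in>S. mpoly_var i)"

text \<open>
  Gates have arbitrary finite fan-in. A gate without children computes the constant \<open>0\<close>
  (for a sum) or \<open>1\<close> (for a product) and, like a constant leaf, contributes nothing to the size.
\<close>

datatype 'a formula =
    Var nat
  | Const 'a
  | Plus "'a formula list"
  | Times "'a formula list"

primrec computed_poly :: "'a::comm_ring_1 formula \<Rightarrow> 'a mpoly" where
  "computed_poly (Var i) = mpoly_var i"
| "computed_poly (Const a) = mpoly_const a"
| "computed_poly (Plus fs) = sum_list (map computed_poly fs)"
| "computed_poly (Times fs) = prod_list (map computed_poly fs)"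

primrec formula_vars :: "'a formula \<Rightarrow> nat set" where
  "formula_vars (Var i) = {i}"
| "formula_vars (Const a) = {}"
| "formula_vars (Plus fs) = \<Union> (set (map formula_vars fs))"
| "formula_vars (Times fs) = \<Union> (set (map formula_vars fs))"

text \<open>The number of leaves labelled by a variable, counted with multiplicity.\<close>

primrec formula_size :: "'a formula \<Rightarrow> nat" where
  "formula_size (Var i) = 1"
| "formula_size (Const a) = 0"
| "formula_size (Plus fs) = sum_list (map formula_size fs)"
| "formula_size (Times fs) = sum_list (map formula_size fs)"

text \<open>
  The absolute constant of the lower bound. It has to be the same for all fields, and HOL cannot
  quantify over the field (a type) below an existential quantifier over the constant: a
  statement \<open>\<exists>c > 0. \<dots>\<close> about formulas over \<open>'a\<close> would let \<open>c\<close> depend on \<open>'a\<close>.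
  The constant is therefore a fixed real number. Its value comes from the following argument,
  which gives the bound even with \<open>1/4\<close>; nothing depends on the exact choice.

  The case \<open>d = 1\<close> is clear, since every variable must occur. Let \<open>d \<ge> 2\<close>, and take a formula
  of size \<open>s\<close> with binary gates. As long as it has at least \<open>d/2\<close> variable leaves, replace a
  minimal subformula with at least \<open>d/2\<close> of them (hence with at most \<open>d - 1\<close>) by the constant
  term of its polynomial. This writes \<open>e\<^sub>d\<close> as \<open>R + (\<Sum>i<k. A\<^sub>i B\<^sub>i)\<close> with \<open>k \<le> 2s/d\<close>,
  \<open>deg R < d\<close> and all \<open>A\<^sub>i\<close>, \<open>B\<^sub>i\<close> vanishing at the origin. On the common zero set of the
  \<open>A\<^sub>i\<close> and \<open>B\<^sub>i\<close>, of dimension at least \<open>n - 2k\<close>, all partial derivatives of \<open>e\<^sub>d - R\<close> vanish.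
  Their leading forms are the partial derivatives of \<open>e\<^sub>d\<close>, and at a common zero of those every
  coordinate is a root of the polynomial \<open>\<Sum>i<d. e\<^bsub>d-1-i\<^esub> (-t)\<^sup>i\<close> of degree \<open>d - 1\<close> in \<open>t\<close>, so
  that the dimension is at most \<open>d - 1\<close>. Hence \<open>n - 2k \<le> d - 1\<close> and \<open>s \<ge> d (n - d + 1) / 4\<close>.
\<close>

definition bound_const :: real where
  "bound_const = 1 / 8"

end

theory Submission
  imports Defs "HOL-Library.FuncSet"
begin

text \<open>
  Cutting the formula at minimal products of degree at least \<open>t \<approx> d/2\<close> yields
  \<open>e\<^sub>d = R + (\<Sum>a\<in>A. g\<^sub>a a)\<close> with \<open>|A| \<le> s/t\<close>, \<open>deg R < d\<close> and all \<open>a\<close>, \<open>g\<^sub>a\<close> vanishing at the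
  origin. Differentiating, the ideal of \<open>F = {a, g\<^sub>a}\<close> contains polynomials with leading forms
  \<open>\<partial>\<^sub>j e\<^sub>d = (- x\<^sub>j)\<^bsup>d-1\<^esup> + (\<Sum>l=1..d-1. (- x\<^sub>j)\<^bsup>d-1-l\<^esup> e\<^sub>l)\<close>.

  Dimension theory is replaced by counting modulo the power \<open>m\<^sup>D\<close> of the maximal ideal at the
  origin. Using these leading forms to lower exponents, every polynomial is, modulo \<open>(F) + m\<^sup>D\<close>, a
  combination of products of a monomial with exponents below \<open>d - 1\<close> and a monomial in
  \<open>e\<^sub>1, \<dots>, e\<^bsub>d-1\<^esub>\<close>. As \<open>F \<subseteq> m\<close>, substituting repeatedly for the coefficients of elements of \<open>(F)\<close>
  shows that these products times monomials in \<open>F\<close> span modulo \<open>m\<^sup>D\<close>. There are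
  \<open>O(D\<^bsup>|F| + d - 1\<^esup>)\<close> of them, but the order of \<open>D\<^sup>n\<close> independent monomials, so
  \<open>n \<le> |F| + d - 1 \<le> 2s/t + d - 1\<close>.
\<close>

section \<open>Polynomials, monomials and degrees\<close>

abbreviation monomial :: "(nat \<Rightarrow>\<^sub>0 nat) \<Rightarrow> 'a::comm_ring_1 mpoly" where
  "monomial m \<equiv> Poly_Mapping.single m 1"

lemma mpoly_const_add: "mpoly_const (a + b) = mpoly_const a + mpoly_const b"
  by (simp add: mpoly_const_def single_add)

lemma mpoly_const_mult: "mpoly_const (a * b) = mpoly_const a * mpoly_const b"
  by (simp add: mpoly_const_def mult_single)

text \<open>The ring as a module over itself: its subspaces are the ideals, and
  \<open>ideal.span A\<close> is the ideal generated by \<open>A\<close>.\<close>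

global_interpretation ideal: module "(*) :: 'a::comm_ring_1 mpoly \<Rightarrow> 'a mpoly \<Rightarrow> 'a mpoly"
  by unfold_locales (simp_all add: algebra_simps)

text \<open>The same ring as a vector space over the coefficient field. The final count compares an
  independent set with a spanning set here.\<close>

global_interpretation vs: vector_space "\<lambda>c p. mpoly_const c * p :: 'a::field mpoly"
proof unfold_locales
  fix a b :: 'a and p q :: "'a mpoly"
  show "mpoly_const a * (mpoly_const b * p) = mpoly_const (a * b) * p"
    by (simp only: mpoly_const_mult mult.assoc)
  show "mpoly_const (a + b) * p = mpoly_const a * p + mpoly_const b * p"
    by (simp only: mpoly_const_add distrib_right)
  show "mpoly_const 1 * p = p"
    by (simp add: mpoly_const_def)
  show "mpoly_const a * (p + q) = mpoly_const a * p + mpoly_const a * q"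
    by (rule distrib_left)
qed

text \<open>For the regular module this simp rule reassociates products and makes \<open>mult.assoc\<close> loop.\<close>

declare ideal.scale_scale [simp del] vs.scale_scale [simp del]

lemma mpoly_const_0 [simp]: "mpoly_const 0 = 0"
  by (simp add: mpoly_const_def)

lemma mpoly_const_mult_monomial: "mpoly_const c * monomial m = Poly_Mapping.single m c"
  by (simp add: mpoly_const_def mult_single)

lemma poly_mapping_eq_sum_single:
  fixes p :: "'b \<Rightarrow>\<^sub>0 'a::comm_monoid_add"
  shows "p = (\<Sum>m\<in>Poly_Mapping.keys p. Poly_Mapping.single m (Poly_Mapping.lookup p m))"
proof (rule poly_mapping_eqI)
  fix k
  have "(\<Sum>m\<in>Poly_Mapping.keys p.
      Poly_Mapping.lookup (Poly_Mapping.single m (Poly_Mapping.lookup p m)) k) =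
    (\<Sum>m\<in>Poly_Mapping.keys p. if m = k then Poly_Mapping.lookup p m else 0)"
    by (intro sum.cong) (auto simp: lookup_single when_def)
  then show "Poly_Mapping.lookup p k = Poly_Mapping.lookup (\<Sum>m\<in>Poly_Mapping.keys p.
      Poly_Mapping.single m (Poly_Mapping.lookup p m)) k"
    by (simp add: lookup_sum in_keys_iff)
qed

lemma mpoly_induct_single [case_names single add]:
  fixes p :: "'a::comm_ring_1 mpoly"
  assumes "\<And>m c. P (Poly_Mapping.single m c)" "\<And>p q. P p \<Longrightarrow> P q \<Longrightarrow> P (p + q)"
  shows "P p"
proof -
  have "P (\<Sum>m\<in>A. Poly_Mapping.single m (Poly_Mapping.lookup p m))" if "finite A" for A
    using that
  proof (induction A)
    case empty
    show ?case using assms(1)[of 0 0] by simp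
  next
    case (insert x F)
    then show ?case using assms by simp
  qed
  from this[of "Poly_Mapping.keys p"] show ?thesis
    unfolding poly_mapping_eq_sum_single[of p, symmetric] by simp
qed

section \<open>Total degree of monomials and degree bounds for polynomials\<close>

definition mdeg :: "(nat \<Rightarrow>\<^sub>0 nat) \<Rightarrow> nat" where
  "mdeg m = (\<Sum>i\<in>Poly_Mapping.keys m. Poly_Mapping.lookup m i)"

lemma mdeg_superset:
  "finite A \<Longrightarrow> Poly_Mapping.keys m \<subseteq> A \<Longrightarrow> mdeg m = (\<Sum>i\<in>A. Poly_Mapping.lookup m i)"
  unfolding mdeg_def by (rule sum.mono_neutral_left) (auto simp: in_keys_iff)

lemma mdeg_add: "mdeg (a + b) = mdeg a + mdeg b"
proof -
  let ?A = "Poly_Mapping.keys a \<union> Poly_Mapping.keys b"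
  have "mdeg (a + b) = (\<Sum>i\<in>?A. Poly_Mapping.lookup (a + b) i)"
    by (rule mdeg_superset) (auto dest: keys_add[THEN subsetD])
  also have "\<dots> = mdeg a + mdeg b"
    by (simp add: mdeg_superset[of ?A] lookup_add sum.distrib)
  finally show ?thesis .
qed

lemma mdeg_0 [simp]: "mdeg 0 = 0"
  by (simp add: mdeg_def)

lemma mdeg_eq_0_iff: "mdeg m = 0 \<longleftrightarrow> m = 0"
  by (auto simp: mdeg_def in_keys_iff intro!: poly_mapping_eqI)

lemma mdeg_single [simp]: "mdeg (Poly_Mapping.single i k) = k"
  by (simp add: mdeg_def)

text \<open>Natural exponents cannot cancel, so the general inclusion becomes an equality.\<close>

lemma keys_add_nat:
  fixes a b :: "'b \<Rightarrow>\<^sub>0 nat"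
  shows "Poly_Mapping.keys (a + b) = Poly_Mapping.keys a \<union> Poly_Mapping.keys b"
  by (auto simp: in_keys_iff lookup_add)

text \<open>A bound instead of a degree: zero satisfies every bound, so cancellation needs no case
  distinction.\<close>

definition deg_le :: "nat \<Rightarrow> 'a::comm_ring_1 mpoly \<Rightarrow> bool" where
  "deg_le q p \<longleftrightarrow> (\<forall>m\<in>Poly_Mapping.keys p. mdeg m \<le> q)"

lemma deg_le_add: "deg_le q a \<Longrightarrow> deg_le q b \<Longrightarrow> deg_le q (a + b)"
  unfolding deg_le_def using keys_add[of a b] by blast

lemma deg_le_uminus: "deg_le q a \<Longrightarrow> deg_le q (- a)"
  by (simp add: deg_le_def in_keys_iff)

lemma deg_le_diff: "deg_le q a \<Longrightarrow> deg_le q b \<Longrightarrow> deg_le q (a - b)"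
  using deg_le_add[of q a "- b"] deg_le_uminus by fastforce

lemma deg_le_mult: "deg_le q a \<Longrightarrow> deg_le r b \<Longrightarrow> deg_le (q + r) (a * b)"
  unfolding deg_le_def using keys_mult[of a b] by (fastforce simp: mdeg_add intro: add_mono)

lemma deg_le_trans: "deg_le q p \<Longrightarrow> q \<le> r \<Longrightarrow> deg_le r p"
  by (auto simp: deg_le_def)

lemma deg_le_const [simp]: "deg_le q (mpoly_const c)"
  by (simp add: deg_le_def mpoly_const_def)

lemma deg_le_0 [simp]: "deg_le q 0"
  by (simp add: deg_le_def)

lemma deg_le_single: "mdeg m \<le> q \<Longrightarrow> deg_le q (Poly_Mapping.single m c)"
  by (simp add: deg_le_def)

lemma deg_le_var [simp]: "1 \<le> q \<Longrightarrow> deg_le q (mpoly_var i)"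
  by (simp add: deg_le_single mpoly_var_def)

lemma deg_le_sum: "(\<And>x. x \<in> A \<Longrightarrow> deg_le q (f x)) \<Longrightarrow> deg_le q (sum f A)"
  by (induction A rule: infinite_finite_induct) (auto intro: deg_le_add)

lemma deg_le_power: "deg_le 1 p \<Longrightarrow> deg_le k (p ^ k)"
  using deg_le_const[of 0 1] deg_le_mult[of 1 p]
  by (induction k) (auto simp: mpoly_const_def)

lemma mpoly_var_power: "mpoly_var i ^ k = monomial (Poly_Mapping.single i k)"
  by (induction k) (simp_all add: mpoly_var_def mult_single single_one flip: single_add)

definition const_coeff :: "'a::comm_ring_1 mpoly \<Rightarrow> 'a" where
  "const_coeff p = Poly_Mapping.lookup p 0"

lemma const_coeff_diff_const [simp]: "const_coeff (p - mpoly_const (const_coeff p)) = 0"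
  by (simp add: const_coeff_def mpoly_const_def lookup_minus)

section \<open>Cutting a formula\<close>

text \<open>\<open>s\<close> bounds the size of a formula, \<open>r\<close> the degree left after cutting; every generator in \<open>A\<close> is
  paid for by \<open>t\<close> variable leaves.\<close>

definition split_poly :: "nat \<Rightarrow> nat \<Rightarrow> nat \<Rightarrow> 'a::comm_ring_1 mpoly \<Rightarrow> bool" where
  "split_poly d t s p \<longleftrightarrow> (\<exists>A R r. finite A \<and> (\<forall>a\<in>A. deg_le (d - 1) a \<and> const_coeff a = 0) \<and>
     p - R \<in> ideal.span A \<and> deg_le r R \<and> r < t \<and> card A * t + r \<le> s)"

lemma split_polyI:
  assumes "finite A" "\<And>a. a \<in> A \<Longrightarrow> deg_le (d - 1) a" "\<And>a. a \<in> A \<Longrightarrow> const_coeff a = 0"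
    "p - R \<in> ideal.span A" "deg_le r R" "r < t" "card A * t + r \<le> s"
  shows "split_poly d t s p"
  using assms unfolding split_poly_def by blast

lemma split_poly_const: "0 < t \<Longrightarrow> split_poly d t s (mpoly_const c)"
  by (rule split_polyI[of "{}" _ _ "mpoly_const c" 0]) (auto simp: ideal.span_zero)

text \<open>For \<open>t = 1\<close> the remainder must be constant, so the variable itself becomes
  a generator. For larger \<open>t\<close> it stays in the remainder.\<close>

lemma split_poly_var:
  assumes "0 < t" "2 \<le> d"
  shows "split_poly d t 1 (mpoly_var i :: 'a::comm_ring_1 mpoly)"
proof (cases "t = 1")
  case True
  have "const_coeff (mpoly_var i :: 'a mpoly) = 0"
    using mdeg_single[of i 1]
    by (auto simp: const_coeff_def mpoly_var_def lookup_single when_def simp del: mdeg_single)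
  then show ?thesis
    by (intro split_polyI[of "{mpoly_var i}" _ _ 0 0])
      (use True assms in \<open>auto intro: ideal.span_base\<close>)
next
  case False
  show ?thesis
    by (rule split_polyI[of "{}" _ _ "mpoly_var i" 1])
      (use False assms in \<open>auto simp: ideal.span_zero\<close>)
qed

lemma split_poly_plus:
  assumes "split_poly d t s p" "split_poly d t s' p'"
  shows "split_poly d t (s + s') (p + p')"
proof -
  obtain A R r where A: "finite A" "\<forall>a\<in>A. deg_le (d - 1) a \<and> const_coeff a = 0"
     "p - R \<in> ideal.span A" "deg_le r R" "r < t" "card A * t + r \<le> s"
    using assms(1) unfolding split_poly_def by blast
  obtain A' R' r' where A': "finite A'" "\<forall>a\<in>A'. deg_le (d - 1) a \<and> const_coeff a = 0"
     "p' - R' \<in> ideal.span A'" "deg_le r' R'" "r' < t" "card A' * t + r' \<le> s'"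
    using assms(2) unfolding split_poly_def by blast
  show ?thesis
  proof (rule split_polyI[of "A \<union> A'" _ _ "R + R'" "max r r'"])
    have "(p - R) + (p' - R') \<in> ideal.span (A \<union> A')"
      by (rule ideal.span_add)
        (use A(3) A'(3) ideal.span_mono[of A "A \<union> A'"] ideal.span_mono[of A' "A \<union> A'"] in auto)
    then show "p + p' - (R + R') \<in> ideal.span (A \<union> A')"
      by (simp add: algebra_simps)
    show "deg_le (max r r') (R + R')"
      by (intro deg_le_add deg_le_trans[OF A(4)] deg_le_trans[OF A'(4)]) auto
    have "card (A \<union> A') * t \<le> card A * t + card A' * t"
      by (metis add_mult_distrib card_Un_le mult_le_mono1)
    then show "card (A \<union> A') * t + max r r' \<le> s + s'"
      using A(6) A'(6) by linarith
  qed (use A A' in auto)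
qed

text \<open>Modulo the generators the product is \<open>R * R'\<close>. If \<open>r + r' < t\<close>
  it is kept as the new remainder. Otherwise it is cut: minus its constant term it becomes a
  generator. Its degree is at most 2t - 2, hence at most d - 1, and the \<open>r + r'\<close> leaves
  not yet charged pay for it.\<close>

lemma split_poly_times:
  assumes "split_poly d t s p" "split_poly d t s' p'" and t: "2 * t \<le> d + 1"
  shows "split_poly d t (s + s') (p * p')"
proof -
  obtain A R r where A: "finite A" "\<forall>a\<in>A. deg_le (d - 1) a \<and> const_coeff a = 0"
     "p - R \<in> ideal.span A" "deg_le r R" "r < t" "card A * t + r \<le> s"
    using assms(1) unfolding split_poly_def by blast
  obtain A' R' r' where A': "finite A'" "\<forall>a\<in>A'. deg_le (d - 1) a \<and> const_coeff a = 0"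
     "p' - R' \<in> ideal.span A'" "deg_le r' R'" "r' < t" "card A' * t + r' \<le> s'"
    using assms(2) unfolding split_poly_def by blast
  have *: "p * p' - R * R' \<in> ideal.span (A \<union> A')"
  proof -
    have "p - R \<in> ideal.span (A \<union> A')" "p' - R' \<in> ideal.span (A \<union> A')"
      using A(3) A'(3) ideal.span_mono[of A "A \<union> A'"] ideal.span_mono[of A' "A \<union> A'"] by auto
    then have "p' * (p - R) + R * (p' - R') \<in> ideal.span (A \<union> A')"
      by (intro ideal.span_add ideal.span_scale)
    then show ?thesis by (simp add: algebra_simps)
  qed
  have card: "card (A \<union> A') * t \<le> card A * t + card A' * t"
    by (metis add_mult_distrib card_Un_le mult_le_mono1)
  show ?thesis
  proof (cases "r + r' < t")
    case True
    show ?thesis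
      by (rule split_polyI[OF _ _ _ * _ True])
        (use A A' card in \<open>auto intro: deg_le_mult\<close>)
  next
    case False
    define c where "c = mpoly_const (const_coeff (R * R'))"
    define B where "B = insert (R * R' - c) (A \<union> A')"
    show ?thesis
    proof (rule split_polyI[of B _ _ c 0])
      have "(p * p' - R * R') + (R * R' - c) \<in> ideal.span B"
        using * ideal.span_mono[of "A \<union> A'" B]
        by (intro ideal.span_add) (auto simp: B_def intro: ideal.span_base)
      then show "p * p' - c \<in> ideal.span B" by simp
      have "deg_le (r + r') (R * R' - c)"
        using A(4) A'(4) by (auto simp: c_def intro!: deg_le_diff deg_le_mult)
      moreover have "r + r' \<le> d - 1" using A(5) A'(5) t by linarith
      ultimately have "deg_le (d - 1) (R * R' - c)" by (rule deg_le_trans)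
      then show "deg_le (d - 1) b" if "b \<in> B" for b
        using that A(2) A'(2) by (auto simp: B_def)
      have "const_coeff (R * R' - c) = 0" unfolding c_def by simp
      then show "const_coeff b = 0" if "b \<in> B" for b
        using that A(2) A'(2) by (auto simp: B_def)
      have "card B \<le> card (A \<union> A') + 1"
        unfolding B_def by (simp add: card_insert_le_m1 A A' card_insert_if)
      then have "card B * t \<le> (card (A \<union> A') + 1) * t"
        by (rule mult_le_mono1)
      then show "card B * t + 0 \<le> s + s'"
        using card A(6) A'(6) False by simp
    qed (use A A' in \<open>auto simp: B_def c_def\<close>)
  qed
qed

lemma split_poly_computed:
  fixes \<phi> :: "'a::comm_ring_1 formula"
  assumes "0 < t" "2 * t \<le> d + 1" "2 \<le> d"
  shows "split_poly d t (formula_size \<phi>) (computed_poly \<phi>)"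
proof (induction \<phi>)
  case (Var i)
  then show ?case using split_poly_var[OF assms(1,3)] by simp
next
  case (Const c)
  then show ?case using assms by (simp add: split_poly_const)
next
  case (Plus fs)
  have zero: "split_poly d t 0 (0 :: 'a mpoly)"
    using split_poly_const[OF assms(1), of d 0 0] by simp
  from Plus show ?case
    by (induction fs) (auto simp: zero intro: split_poly_plus)
next
  case (Times fs)
  have one: "split_poly d t 0 (1 :: 'a mpoly)"
    using split_poly_const[OF assms(1), of d 0 1] by (simp add: mpoly_const_def)
  from Times show ?case
    by (induction fs) (auto simp: one intro: split_poly_times assms(2))
qed

section \<open>Partial derivatives and elementary symmetric polynomials\<close>

text \<open>Subtraction of exponents is truncated. This is harmless, since a monomial without the
  variable \<open>j\<close> gets the coefficient 0.\<close>

definition pder :: "nat \<Rightarrow> 'a::comm_ring_1 mpoly \<Rightarrow> 'a mpoly" where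
  "pder j p = (\<Sum>m\<in>Poly_Mapping.keys p. Poly_Mapping.single (m - Poly_Mapping.single j 1)
     (of_nat (Poly_Mapping.lookup m j) * Poly_Mapping.lookup p m))"

lemma pder_superset:
  assumes "finite A" "Poly_Mapping.keys p \<subseteq> A"
  shows "pder j p = (\<Sum>m\<in>A. Poly_Mapping.single (m - Poly_Mapping.single j 1)
     (of_nat (Poly_Mapping.lookup m j) * Poly_Mapping.lookup p m))"
  unfolding pder_def
  by (rule sum.mono_neutral_left) (use assms in \<open>auto simp: not_in_keys_iff_lookup_eq_zero\<close>)

lemma pder_add: "pder j (p + q) = pder j p + pder j q"
  using keys_add[of p q]
  by (simp add: pder_superset[of "Poly_Mapping.keys p \<union> Poly_Mapping.keys q"] lookup_add
      single_add ring_distribs sum.distrib)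

lemma pder_0 [simp]: "pder j 0 = 0"
  by (simp add: pder_def)

lemma pder_single: "pder j (Poly_Mapping.single m c) =
    Poly_Mapping.single (m - Poly_Mapping.single j 1) (of_nat (Poly_Mapping.lookup m j) * c)"
  by (simp add: pder_superset[of "{m}"])

lemma pder_const [simp]: "pder j (mpoly_const c) = 0"
  by (simp add: mpoly_const_def pder_single)

lemma pder_1 [simp]: "pder j 1 = 0"
  using pder_const[of j 1] by (simp add: mpoly_const_def)

lemma pder_var: "pder j (mpoly_var i) = (if i = j then 1 else 0)"
  by (simp add: mpoly_var_def pder_single lookup_single when_def)

lemma pder_sum: "pder j (sum f A) = (\<Sum>x\<in>A. pder j (f x))"
  by (induction A rule: infinite_finite_induct) (auto simp: pder_add)

lemma pder_mult_single:
  "pder j (Poly_Mapping.single a u * Poly_Mapping.single b v) =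
   pder j (Poly_Mapping.single a u) * Poly_Mapping.single b v +
   Poly_Mapping.single a u * pder j (Poly_Mapping.single b v)"
proof -
  let ?e = "Poly_Mapping.single j (1::nat)"
  \<comment> \<open>Truncated subtraction commutes with addition only if the variable
    \<open>j\<close> occurs in \<open>c\<close>. In the other case the coefficient vanishes.\<close>
  have *: "c - ?e + d = c + d - ?e" if "Poly_Mapping.lookup c j \<noteq> 0" for c d :: "nat \<Rightarrow>\<^sub>0 nat"
    by (rule poly_mapping_eqI) (use that in \<open>auto simp: lookup_add lookup_minus lookup_single when_def\<close>)
  have 1: "pder j (Poly_Mapping.single a u) * Poly_Mapping.single b v =
      Poly_Mapping.single (a + b - ?e) (of_nat (Poly_Mapping.lookup a j) * u * v)"
    using *[of a b] by (cases "Poly_Mapping.lookup a j = 0") (auto simp: pder_single mult_single)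
  have 2: "Poly_Mapping.single a u * pder j (Poly_Mapping.single b v) =
      Poly_Mapping.single (a + b - ?e) (of_nat (Poly_Mapping.lookup b j) * u * v)"
    using *[of b a] by (cases "Poly_Mapping.lookup b j = 0")
      (auto simp: pder_single mult_single add.commute mult_ac)
  show ?thesis
    unfolding 1 2 by (simp add: mult_single pder_single lookup_add ring_distribs single_add mult.assoc)
qed

lemma pder_mult: "pder j (p * q) = pder j p * q + p * pder j q"
proof (induction p rule: mpoly_induct_single)
  case (single m c)
  show ?case
  proof (induction q rule: mpoly_induct_single)
    case (single m c)
    show ?case by (rule pder_mult_single)
  next
    case (add p q)
    then show ?case by (simp add: distrib_left pder_add add_ac)
  qed
next
  case (add p q)
  then show ?case by (simp add: distrib_right pder_add add_ac)
qed

lemma deg_le_pder: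
  assumes "deg_le q p"
  shows "deg_le (q - 1) (pder j p)"
  unfolding pder_def
proof (rule deg_le_sum)
  fix m
  assume m: "m \<in> Poly_Mapping.keys p"
  let ?e = "Poly_Mapping.single j (1::nat)"
  show "deg_le (q - 1) (Poly_Mapping.single (m - ?e)
      (of_nat (Poly_Mapping.lookup m j) * Poly_Mapping.lookup p m))"
  proof (cases "Poly_Mapping.lookup m j = 0")
    case False
    then have "m = (m - ?e) + ?e"
      by (intro poly_mapping_eqI) (auto simp: lookup_add lookup_minus lookup_single when_def)
    then have "mdeg m = mdeg (m - ?e) + 1"
      using mdeg_add[of "m - ?e" ?e] by simp
    then show ?thesis
      using assms m by (intro deg_le_single) (auto simp: deg_le_def)
  qed simp
qed

section \<open>Elementary symmetric polynomials in a set of variables\<close>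

definition esym :: "nat set \<Rightarrow> nat \<Rightarrow> 'a::comm_ring_1 mpoly" where
  "esym A c = (\<Sum>S | S \<subseteq> A \<and> card S = c. \<Prod>i\<in>S. mpoly_var i)"

lemma elem_sym_eq_esym: "elem_sym n d = esym {1..n} d"
  by (simp add: elem_sym_def esym_def)

lemma esym_0: "finite A \<Longrightarrow> esym A 0 = 1"
proof -
  assume "finite A"
  then have "{S. S \<subseteq> A \<and> card S = 0} = {{}}"
    using finite_subset by fastforce
  then show ?thesis unfolding esym_def by simp
qed

lemma esym_insert:
  assumes "finite A" "j \<notin> A"
  shows "esym (insert j A) (Suc c) = esym A (Suc c) + mpoly_var j * esym A c"
proof -
  let ?B = "{S. S \<subseteq> A \<and> card S = Suc c}" and ?C = "{S. S \<subseteq> A \<and> card S = c}"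
  have fin: "finite S" if "S \<subseteq> A" for S using that assms(1) finite_subset by blast
  have inj: "inj_on (insert j) ?C"
    using assms(2) by (auto simp: inj_on_def dest: insert_ident[THEN iffD1, rotated -1])
  have eq: "{S. S \<subseteq> insert j A \<and> card S = Suc c} = ?B \<union> insert j ` ?C"
  proof (intro equalityI subsetI)
    fix S assume S: "S \<in> {S. S \<subseteq> insert j A \<and> card S = Suc c}"
    show "S \<in> ?B \<union> insert j ` ?C"
    proof (cases "j \<in> S")
      case True
      then have "S = insert j (S - {j})" "S - {j} \<in> ?C" using S by auto
      then show ?thesis by blast
    qed (use S in auto)
  next
    fix S assume "S \<in> ?B \<union> insert j ` ?C"
    then show "S \<in> {S. S \<subseteq> insert j A \<and> card S = Suc c}"
    proof
      assume "S \<in> insert j ` ?C"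
      then obtain T where "S = insert j T" "T \<subseteq> A" "card T = c" by blast
      moreover from this have "j \<notin> T" using assms by blast
      ultimately show ?thesis using fin[of T] by auto
    qed auto
  qed
  have "esym (insert j A) (Suc c) =
      (\<Sum>S\<in>?B. \<Prod>i\<in>S. mpoly_var i) + (\<Sum>S\<in>insert j ` ?C. \<Prod>i\<in>S. mpoly_var i :: 'a mpoly)"
    unfolding esym_def eq
    by (rule sum.union_disjoint) (use assms in auto)
  also have "(\<Sum>S\<in>insert j ` ?C. \<Prod>i\<in>S. mpoly_var i :: 'a mpoly) =
      (\<Sum>S\<in>?C. mpoly_var j * (\<Prod>i\<in>S. mpoly_var i))"
    unfolding sum.reindex[OF inj] o_def
    by (intro sum.cong refl prod.insert) (use assms fin in auto)
  finally show ?thesis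
    by (simp add: esym_def sum_distrib_left)
qed

text \<open>Unrolls the recursion e_c(A) = e_c(A + j) - x_j e_{c-1}(A) given by
  \<open>esym_insert\<close>. Together with \<open>pder_esym\<close> it shows that a partial
  derivative of e_d is, up to sign, monic of degree d - 1 in x_j, with the e_l as its other
  coefficients. No division occurs, so the characteristic does not matter.\<close>

lemma esym_remove:
  assumes "finite A" "j \<notin> A"
  shows "esym A c = (- mpoly_var j) ^ c +
    (\<Sum>l=1..c. (- mpoly_var j) ^ (c - l) * esym (insert j A) l :: 'a::comm_ring_1 mpoly)"
proof (induction c)
  case 0
  then show ?case using assms by (simp add: esym_0)
next
  case (Suc c)
  let ?x = "- mpoly_var j :: 'a mpoly" and ?e = "esym (insert j A) :: nat \<Rightarrow> 'a mpoly"
  have "?e (Suc c) = esym A (Suc c) + mpoly_var j * esym A c"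
    by (rule esym_insert[OF assms])
  then have "esym A (Suc c) = ?e (Suc c) + ?x * esym A c"
    by simp
  also have "\<dots> = ?e (Suc c) + ?x ^ Suc c + (\<Sum>l=1..c. ?x * (?x ^ (c - l) * ?e l))"
    unfolding Suc.IH distrib_left sum_distrib_left power_Suc by (simp only: add.assoc)
  also have "(\<Sum>l=1..c. ?x * (?x ^ (c - l) * ?e l)) = (\<Sum>l=1..c. ?x ^ (Suc c - l) * ?e l)"
    by (intro sum.cong refl) (simp only: Suc_diff_le atLeastAtMost_iff power_Suc mult.assoc)
  also have "?e (Suc c) + ?x ^ Suc c + (\<Sum>l=1..c. ?x ^ (Suc c - l) * ?e l) =
     ?x ^ Suc c + (\<Sum>l=1..Suc c. ?x ^ (Suc c - l) * ?e l)"
    by (simp add: add_ac del: power_Suc)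
  finally show ?case .
qed

lemma pder_prod_var: "j \<notin> S \<Longrightarrow> pder j (\<Prod>i\<in>S. mpoly_var i) = 0"
  by (induction S rule: infinite_finite_induct) (auto simp: pder_mult pder_var)

text \<open>e_{c+1} is linear in x_j, so the derivative is the cofactor of x_j and carries no
  integer factor that could vanish in positive characteristic.\<close>

lemma pder_esym:
  assumes "finite A" "j \<in> A"
  shows "pder j (esym A (Suc c) :: 'a::comm_ring_1 mpoly) = esym (A - {j}) c"
proof -
  have 0: "pder j (esym (A - {j}) k :: 'a mpoly) = 0" for k
    by (auto simp: esym_def pder_sum intro!: sum.neutral pder_prod_var)
  have "esym A (Suc c) = esym (A - {j}) (Suc c) + (mpoly_var j * esym (A - {j}) c :: 'a mpoly)"
    using esym_insert[of "A - {j}" j c] assms by (simp add: insert_absorb)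
  then show ?thesis
    by (simp add: pder_add pder_mult pder_var 0)
qed

section \<open>Spanning sets modulo powers of the maximal ideal\<close>

text \<open>Extensional exponent functions make the index set finite with \<open>B ^ card S\<close>
  elements. Distinct exponents may give equal products, so only an upper bound on the cardinality
  follows.\<close>

definition power_products :: "'i set \<Rightarrow> ('i \<Rightarrow> 'a::comm_ring_1 mpoly) \<Rightarrow> nat \<Rightarrow> 'a mpoly set" where
  "power_products S g B = (\<lambda>\<gamma>. \<Prod>i\<in>S. g i ^ \<gamma> i) ` (S \<rightarrow>\<^sub>E {..<B})"

lemma finite_power_products: "finite S \<Longrightarrow> finite (power_products S g B)"
  by (simp add: power_products_def finite_PiE)

lemma card_power_products: "finite S \<Longrightarrow> card (power_products S g B) \<le> B ^ card S"
proof -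
  assume "finite S"
  then have "card (power_products S g B) \<le> card (S \<rightarrow>\<^sub>E {..<B})"
    unfolding power_products_def by (intro card_image_le finite_PiE) auto
  then show ?thesis using \<open>finite S\<close> by (simp add: card_PiE)
qed

lemma prod_in_power_products: "(\<And>i. i \<in> S \<Longrightarrow> \<gamma> i < B) \<Longrightarrow> (\<Prod>i\<in>S. g i ^ \<gamma> i) \<in> power_products S g B"
  unfolding power_products_def by (rule image_eqI[of _ _ "restrict \<gamma> S"]) auto

lemma power_productsE:
  assumes "u \<in> power_products S g B"
  obtains \<gamma> where "u = (\<Prod>i\<in>S. g i ^ \<gamma> i)" "\<forall>i\<in>S. \<gamma> i < B"
  using assms unfolding power_products_def by (auto simp: PiE_iff)

lemma one_in_power_products: "0 < B \<Longrightarrow> 1 \<in> power_products S g B"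
  using prod_in_power_products[of S "\<lambda>_. 0" B g] by simp

lemma power_products_mono: "B \<le> B' \<Longrightarrow> power_products S g B \<subseteq> power_products S g B'"
  by (rule subsetI, erule power_productsE) (auto intro!: prod_in_power_products intro: less_le_trans)

lemma mult_in_power_products:
  assumes "finite S" "i \<in> S" "u \<in> power_products S g B"
  shows "g i * u \<in> power_products S g (Suc B)"
proof -
  obtain \<gamma> where \<gamma>: "u = (\<Prod>i\<in>S. g i ^ \<gamma> i)" "\<forall>i\<in>S. \<gamma> i < B"
    using assms(3) by (rule power_productsE)
  have eq: "g i * u = (\<Prod>k\<in>S. g k ^ (\<gamma>(i := Suc (\<gamma> i))) k)"
  proof -
    have "(\<Prod>k\<in>S - {i}. g k ^ (\<gamma>(i := Suc (\<gamma> i))) k) = (\<Prod>k\<in>S - {i}. g k ^ \<gamma> k)"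
      by (rule prod.cong) auto
    then show ?thesis
      unfolding \<gamma>(1) prod.remove[OF assms(1,2)] by (simp add: mult.assoc)
  qed
  show ?thesis
    unfolding eq
  proof (rule prod_in_power_products)
    fix k assume "k \<in> S"
    then show "(\<gamma>(i := Suc (\<gamma> i))) k < Suc B"
      using \<gamma>(2) assms(2) by (simp add: less_SucI)
  qed
qed

lemma monomial_eq_prod:
  assumes "finite A" "Poly_Mapping.keys m \<subseteq> A"
  shows "monomial m = (\<Prod>i\<in>A. mpoly_var i ^ Poly_Mapping.lookup m i :: 'a::comm_ring_1 mpoly)"
proof -
  have m: "m = (\<Sum>i\<in>A. Poly_Mapping.single i (Poly_Mapping.lookup m i))"
    by (subst poly_mapping_eq_sum_single[of m], rule sum.mono_neutral_left)
      (use assms in \<open>auto simp: not_in_keys_iff_lookup_eq_zero\<close>)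
  have "monomial (sum f A) = (\<Prod>i\<in>A. monomial (f i) :: 'a mpoly)" for f
    using assms(1)
  proof (induction A)
    case (insert x F)
    have "monomial (f x + sum f F) = (monomial (f x) * monomial (sum f F) :: 'a mpoly)"
      by (simp add: mult_single)
    with insert show ?case by simp
  qed simp
  from this[of "\<lambda>i. Poly_Mapping.single i (Poly_Mapping.lookup m i)"] show ?thesis
    unfolding mpoly_var_power m[symmetric] .
qed

text \<open>Multiplication by \<open>g\<close> is linear, so it can be checked on a spanning
  set.\<close>

lemma vs_mult_span:
  fixes g :: "'a::field mpoly"
  assumes "y \<in> vs.span S" "\<And>x. x \<in> S \<Longrightarrow> g * x \<in> vs.span T"
  shows "g * y \<in> vs.span T"
  using assms(1)
proof (induction rule: vs.span_induct_alt)
  case base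
  show ?case by (simp add: vs.span_zero)
next
  case (step c x y)
  have "g * (mpoly_const c * x + y) = mpoly_const c * (g * x) + g * y"
    by (simp add: distrib_left mult.left_commute)
  with step assms(2) show ?case by (simp add: vs.span_add vs.span_scale)
qed

lemma in_vs_span_if_monomials:
  fixes p :: "'a::field mpoly"
  assumes "\<And>m. m \<in> Poly_Mapping.keys p \<Longrightarrow> monomial m \<in> vs.span S"
  shows "p \<in> vs.span S"
proof -
  have "(\<Sum>m\<in>Poly_Mapping.keys p. mpoly_const (Poly_Mapping.lookup p m) * monomial m) \<in> vs.span S"
    by (intro vs.span_sum vs.span_scale assms)
  then show ?thesis
    unfolding mpoly_const_mult_monomial poly_mapping_eq_sum_single[of p, symmetric] .
qed

text \<open>The ideal \<open>m\<^sup>q\<close> in the variables \<open>x\<^sub>1, \<dots>, x\<^sub>n\<close>, together with all monomials that involve further variables, so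
  that working modulo \<open>high n q\<close> ignores those.\<close>

definition high :: "nat \<Rightarrow> nat \<Rightarrow> 'a::comm_ring_1 mpoly set" where
  "high n q = {p. \<forall>m\<in>Poly_Mapping.keys p. Poly_Mapping.keys m \<subseteq> {1..n} \<longrightarrow> q \<le> mdeg m}"

text \<open>If a product of monomials involves only x_1, ..., x_n, then so do its factors, and both
  degree bounds apply.\<close>

lemma high_mult:
  assumes "a \<in> high n q" "b \<in> high n r"
  shows "a * b \<in> high n (q + r)"
proof -
  have "q + r \<le> mdeg m" if m: "m \<in> Poly_Mapping.keys (a * b)" "Poly_Mapping.keys m \<subseteq> {1..n}" for m
  proof -
    obtain x y where "m = x + y" "x \<in> Poly_Mapping.keys a" "y \<in> Poly_Mapping.keys b"
      using m(1) keys_mult[of a b] by blast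
    with m(2) assms show ?thesis
      by (auto simp: high_def keys_add_nat mdeg_add intro!: add_mono)
  qed
  then show ?thesis by (simp add: high_def)
qed

lemma high_0: "p \<in> high n 0"
  by (simp add: high_def)

lemma high_1: "const_coeff p = 0 \<Longrightarrow> p \<in> high n 1"
  by (auto simp: high_def const_coeff_def in_keys_iff Suc_le_eq mdeg_eq_0_iff intro!: gr0I)

lemma high_antimono: "q \<le> r \<Longrightarrow> high n r \<subseteq> high n q"
  by (auto simp: high_def)

lemma subspace_high: "ideal.subspace (high n q)"
proof (rule ideal.subspaceI)
  show "x + y \<in> high n q" if "x \<in> high n q" "y \<in> high n q" for x y :: "'a mpoly"
    using that keys_add[of x y] by (auto simp: high_def)
  show "c * x \<in> high n q" if "x \<in> high n q" for c x :: "'a mpoly"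
    using high_mult[OF high_0[of c n] that] by simp
qed (simp add: high_def)

section \<open>Reduction by the leading forms\<close>

definition reps :: "nat \<Rightarrow> nat \<Rightarrow> nat \<Rightarrow> 'a::comm_ring_1 mpoly set" where
  "reps n d q = (\<lambda>(u, v). u * v) `
     (power_products {1..n} mpoly_var (d - 1) \<times> power_products {1..d - 1} (esym {1..n}) (Suc q))"

lemma finite_reps: "finite (reps n d q)"
  by (simp add: reps_def finite_power_products)

text \<open>The factor \<open>(d - 1) ^ n\<close> does not depend on \<open>q\<close>: for fixed
  \<open>n\<close> and \<open>d\<close> the number grows at most like q^(d-1).\<close>

lemma card_reps: "card (reps n d q :: 'a::comm_ring_1 mpoly set) \<le> (d - 1) ^ n * Suc q ^ (d - 1)"
proof -
  have "card (reps n d q :: 'a mpoly set) \<le>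
      card (power_products {1..n} (mpoly_var :: _ \<Rightarrow> 'a mpoly) (d - 1) \<times>
        power_products {1..d - 1} (esym {1..n} :: _ \<Rightarrow> 'a mpoly) (Suc q))"
    unfolding reps_def by (rule card_image_le) (simp add: finite_power_products)
  also have "\<dots> \<le> (d - 1) ^ n * Suc q ^ (d - 1)"
    unfolding card_cartesian_product
    using card_power_products[of "{1..n}" mpoly_var "d - 1"] card_power_products[of "{1..d - 1}" "esym {1..n}" "Suc q"]
    by (intro mult_mono) auto
  finally show ?thesis .
qed

lemma reps_mono: "q \<le> r \<Longrightarrow> reps n d q \<subseteq> reps n d r"
  unfolding reps_def using power_products_mono[of "Suc q" "Suc r"] by (intro image_mono Sigma_mono) auto

lemma esym_mult_reps:
  assumes "l \<in> {1..d - 1}" "w \<in> reps n d q"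
  shows "esym {1..n} l * w \<in> reps n d (Suc q)"
proof -
  obtain u v where "u \<in> power_products {1..n} mpoly_var (d - 1)"
    "v \<in> power_products {1..d - 1} (esym {1..n}) (Suc q)" "w = u * v"
    using assms(2) by (auto simp: reps_def)
  with assms(1) mult_in_power_products[of "{1..d - 1}" l v "esym {1..n}"] show ?thesis
    unfolding reps_def by (intro image_eqI[of _ _ "(u, esym {1..n} l * v)"]) (auto simp: mult_ac)
qed

text \<open>Induction on the degree. A monomial with all exponents below \<open>d - 1\<close> is a
  representative. Otherwise x_j^(d-1) divides it and is rewritten modulo \<open>J\<close> by
  \<open>esym_remove\<close>. The factors e_l are taken out before the induction hypothesis is
  applied, so only the degree of their cofactors counts, and that degree has dropped. Each such step
  raises one exponent of an e_l by one, which is why these exponents are at most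
  \<open>q\<close>.\<close>

lemma mpoly_in_span_reps:
  fixes J :: "'a::field mpoly set"
  assumes d: "2 \<le> d" and J: "ideal.subspace J"
    and outside: "\<And>m. \<not> Poly_Mapping.keys m \<subseteq> {1..n} \<Longrightarrow> monomial m \<in> J"
    and esym: "\<And>j. j \<in> {1..n} \<Longrightarrow> \<exists>r. deg_le (d - 2) r \<and> esym ({1..n} - {j}) (d - 1) - r \<in> J"
  shows "deg_le q p \<Longrightarrow> p \<in> vs.span (reps n d q \<union> J)"
proof (induction q arbitrary: p rule: less_induct)
  case (less q)
  show ?case
  proof (rule in_vs_span_if_monomials)
    fix m assume "m \<in> Poly_Mapping.keys p"
    then have m: "mdeg m \<le> q" using less.prems by (simp add: deg_le_def)
    consider "\<not> Poly_Mapping.keys m \<subseteq> {1..n}"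
      | "Poly_Mapping.keys m \<subseteq> {1..n}" "\<forall>j\<in>{1..n}. Poly_Mapping.lookup m j < d - 1"
      | j where "j \<in> {1..n}" "d - 1 \<le> Poly_Mapping.lookup m j"
      by force
    then show "monomial m \<in> vs.span (reps n d q \<union> J)"
    proof cases
      case 1
      then show ?thesis by (intro vs.span_base) (simp add: outside)
    next
      case 2
      have "monomial m \<in> power_products {1..n} (mpoly_var :: nat \<Rightarrow> 'a mpoly) (d - 1)"
        unfolding monomial_eq_prod[OF finite_atLeastAtMost 2(1)]
        by (rule prod_in_power_products) (use 2(2) in blast)
      then have "monomial m \<in> (reps n d q :: 'a mpoly set)"
        unfolding reps_def by (intro image_eqI[of _ _ "(monomial m, 1)"]) (auto simp: one_in_power_products)
      then show ?thesis by (intro vs.span_base) simp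
    next
      case 3
      define m' where "m' = m - Poly_Mapping.single j (d - 1)"
      have mm': "m = Poly_Mapping.single j (d - 1) + m'"
        unfolding m'_def using 3(2)
        by (intro poly_mapping_eqI) (auto simp: lookup_add lookup_minus lookup_single when_def)
      have deg: "mdeg m' + (d - 1) \<le> q"
        using m unfolding mm' by (simp add: mdeg_add)
      let ?x = "- mpoly_var j :: 'a mpoly" and ?M = "monomial m' :: 'a mpoly"
      let ?e = "esym ({1..n} - {j}) (d - 1) :: 'a mpoly"
      let ?V = "vs.span (reps n d q \<union> J)"
      obtain r where r: "deg_le (d - 2) r" "?e - r \<in> J"
        using esym[OF 3(1)] by blast
      have "insert j ({1..n} - {j}) = {1..n}" using 3(1) by blast
      then have e: "?e = ?x ^ (d - 1) + (\<Sum>l=1..d - 1. ?x ^ (d - 1 - l) * esym {1..n} l)"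
        using esym_remove[of "{1..n} - {j}" j "d - 1", where 'a = 'a] by simp
      \<comment> \<open>The identity \<open>e\<close>, multiplied by the remaining monomial and
        solved for its leading term. The three kinds of summands lie in \<open>J\<close>, have
        smaller degree, or are e_l times something of smaller degree.\<close>
      have "?M * ?x ^ (d - 1) = ?M * (?e - r) + r * ?M -
          (\<Sum>l=1..d - 1. esym {1..n} l * (?x ^ (d - 1 - l) * ?M))"
        unfolding e by (simp add: ring_distribs sum_distrib_left mult_ac)
      also have "\<dots> \<in> ?V"
      proof (intro vs.span_add vs.span_diff vs.span_sum)
        have "?M * (?e - r) \<in> J" using ideal.subspace_scale[OF J r(2)] .
        then show "?M * (?e - r) \<in> ?V" by (intro vs.span_base) simp
        have "deg_le (d - 2 + mdeg m') (r * ?M)"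
          by (intro deg_le_mult r(1) deg_le_single) simp
        then have "r * ?M \<in> vs.span (reps n d (d - 2 + mdeg m') \<union> J)"
          using deg d by (intro less.IH) auto
        moreover have "reps n d (d - 2 + mdeg m') \<subseteq> (reps n d q :: 'a mpoly set)"
          using deg d by (intro reps_mono) auto
        ultimately show "r * ?M \<in> ?V"
          using vs.span_mono[of "reps n d (d - 2 + mdeg m') \<union> J" "reps n d q \<union> J"] by auto
        fix l assume l: "l \<in> {1..d - 1}"
        have "deg_le k (?x ^ k)" for k
          by (rule deg_le_power) (simp add: deg_le_uminus)
        then have "deg_le (d - 1 - l + mdeg m') (?x ^ (d - 1 - l) * ?M)"
          by (intro deg_le_mult deg_le_single) auto
        then have "deg_le (q - 1) (?x ^ (d - 1 - l) * ?M)"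
          by (rule deg_le_trans) (use deg l in auto)
        then have "?x ^ (d - 1 - l) * ?M \<in> vs.span (reps n d (q - 1) \<union> J)"
          using deg l by (intro less.IH) auto
        then show "esym {1..n} l * (?x ^ (d - 1 - l) * ?M) \<in> ?V"
        proof (rule vs_mult_span)
          fix w assume w: "w \<in> reps n d (q - 1) \<union> J"
          have "Suc (q - 1) = q" using deg l by auto
          with w show "esym {1..n} l * w \<in> ?V"
            using esym_mult_reps[OF l, of w n "q - 1"] ideal.subspace_scale[OF J, of w]
            by (auto intro: vs.span_base)
        qed
      qed
      finally have V: "?M * ?x ^ (d - 1) \<in> ?V" .
      have "monomial m = ?M * mpoly_var j ^ (d - 1)"
        unfolding mm' mpoly_var_power by (simp add: mult_single add.commute)
      moreover have "?x ^ (d - 1) = mpoly_var j ^ (d - 1) \<or> ?x ^ (d - 1) = - (mpoly_var j ^ (d - 1))"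
        using power_minus[of "mpoly_var j :: 'a mpoly" "d - 1"]
        by (cases "even (d - 1)") auto
      ultimately have "monomial m = ?M * ?x ^ (d - 1) \<or> monomial m = - (?M * ?x ^ (d - 1))"
        by auto
      then show ?thesis using V vs.span_neg[OF V] by metis
    qed
  qed
qed

section \<open>Expansion in powers of the ideal generators\<close>

definition ideal_reps :: "nat \<Rightarrow> nat \<Rightarrow> nat \<Rightarrow> 'a::comm_ring_1 mpoly set \<Rightarrow> nat \<Rightarrow> 'a mpoly set" where
  "ideal_reps n d D F q = (\<lambda>(u, w). u * w) ` (power_products F id q \<times> reps n d D)"

lemma card_ideal_reps:
  fixes F :: "'a::comm_ring_1 mpoly set"
  assumes "finite F"
  shows "finite (ideal_reps n d D F q)"
    and "card (ideal_reps n d D F q) \<le> q ^ card F * ((d - 1) ^ n * Suc D ^ (d - 1))"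
proof -
  show "finite (ideal_reps n d D F q)"
    using assms by (simp add: ideal_reps_def finite_power_products finite_reps)
  have "card (ideal_reps n d D F q) \<le> card (power_products F id q \<times> (reps n d D :: 'a mpoly set))"
    unfolding ideal_reps_def
    by (rule card_image_le) (use assms in \<open>simp add: finite_power_products finite_reps\<close>)
  also have "\<dots> \<le> q ^ card F * ((d - 1) ^ n * Suc D ^ (d - 1))"
    unfolding card_cartesian_product
    by (intro mult_mono card_power_products card_reps assms) auto
  finally show "card (ideal_reps n d D F q) \<le> q ^ card F * ((d - 1) ^ n * Suc D ^ (d - 1))" .
qed

text \<open>By \<open>gen\<close>, every polynomial is a combination of representatives plus a sum
  of f * h_f over f in \<open>F\<close>, up to \<open>high n D\<close>. Expanding each h_f modulo
  order \<open>q\<close> by the induction hypothesis and multiplying by f, which has order at least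
  1, gives an expansion modulo order q + 1. The exponents of the generators grow by one at each
  round.\<close>

lemma mpoly_in_span_ideal_reps:
  fixes F :: "'a::field mpoly set"
  assumes F: "finite F" "F \<subseteq> high n 1"
    and gen: "\<And>p. p \<in> vs.span (reps n d D \<union> ideal.span (F \<union> high n D))"
  shows "q \<le> D \<Longrightarrow> p \<in> vs.span (ideal_reps n d D F q \<union> high n q)"
proof (induction q arbitrary: p)
  case 0
  show ?case by (rule vs.span_base) (simp add: high_0)
next
  case (Suc q)
  let ?V = "vs.span (ideal_reps n d D F (Suc q) \<union> high n (Suc q))"
  have F_mult: "f * g \<in> ?V" if "f \<in> F" for f g
  proof (rule vs_mult_span)
    show "g \<in> vs.span (ideal_reps n d D F q \<union> high n q)"
      using Suc by simp
    fix x assume "x \<in> ideal_reps n d D F q \<union> high n q"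
    then show "f * x \<in> ?V"
    proof
      assume "x \<in> ideal_reps n d D F q"
      then obtain u w where "u \<in> power_products F id q" "w \<in> reps n d D" "x = u * w"
        by (auto simp: ideal_reps_def)
      then have "f * x \<in> ideal_reps n d D F (Suc q)"
        unfolding ideal_reps_def using mult_in_power_products[OF F(1) that, of u id q]
        by (intro image_eqI[of _ _ "(f * u, w)"]) (auto simp: mult.assoc)
      then show ?thesis by (intro vs.span_base) simp
    next
      assume "x \<in> high n q"
      then have "f * x \<in> high n (1 + q)"
        using that F(2) by (intro high_mult) auto
      then show ?thesis by (intro vs.span_base) simp
    qed
  qed
  have "reps n d D \<union> ideal.span (F \<union> high n D) \<subseteq> ?V"
  proof (intro Un_least subsetI)
    fix w :: "'a mpoly" assume "w \<in> reps n d D"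
    then have "w \<in> ideal_reps n d D F (Suc q)"
      unfolding ideal_reps_def by (intro image_eqI[of _ _ "(1, w)"]) (auto intro: one_in_power_products)
    then show "w \<in> ?V" by (intro vs.span_base) simp
  next
    fix y assume "y \<in> ideal.span (F \<union> high n D)"
    then obtain x z where "y = x + z" "x \<in> ideal.span F" "z \<in> ideal.span (high n D)"
      unfolding ideal.span_Un by blast
    moreover have "ideal.span (high n D) = (high n D :: 'a mpoly set)"
      by (simp add: subspace_high)
    moreover obtain h where "x = (\<Sum>f\<in>F. h f * f)"
      using \<open>x \<in> ideal.span F\<close> unfolding ideal.span_finite[OF F(1)] by blast
    ultimately have y: "y = (\<Sum>f\<in>F. f * h f) + z" and z: "z \<in> high n D"
      by (simp_all add: mult.commute)
    have "z \<in> high n (Suc q)" using high_antimono[OF Suc.prems] z by blast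
    then show "y \<in> ?V"
      unfolding y by (intro vs.span_add vs.span_sum F_mult) (auto intro: vs.span_base)
  qed
  then show ?case
    using gen[of p] vs.span_minimal[OF _ vs.subspace_span] by blast
qed

text \<open>\<open>T\<close> spans modulo \<open>high n D\<close>, and the coefficients at monomials of degree less than \<open>D\<close>
  do not see \<open>high n D\<close>.\<close>

lemma card_low_monomials_le:
  fixes T :: "'a::field mpoly set"
  assumes T: "finite T" "\<And>p. p \<in> vs.span (T \<union> high n D)"
    and L: "finite L" "\<And>m. m \<in> L \<Longrightarrow> Poly_Mapping.keys m \<subseteq> {1..n}" "\<And>m. m \<in> L \<Longrightarrow> mdeg m < D"
  shows "card L \<le> card T"
proof -
  \<comment> \<open>The linear projection onto the span of the monomials in \<open>L\<close>. It
    fixes these monomials and kills \<open>high n D\<close>, so they lie in the span of the image of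
    \<open>T\<close>.\<close>
  define trunc :: "'a mpoly \<Rightarrow> 'a mpoly" where
    "trunc p = (\<Sum>m\<in>L. mpoly_const (Poly_Mapping.lookup p m) * monomial m)" for p
  have lookup_const_mult:
      "Poly_Mapping.lookup (mpoly_const c * p) m = c * Poly_Mapping.lookup p m" for c :: 'a and p m
    unfolding mpoly_const_def mult_map_scale_conv_mult[symmetric]
    by (simp add: Poly_Mapping.map.rep_eq when_def)
  have trunc_add: "trunc (p + q) = trunc p + trunc q" for p q
    by (simp add: trunc_def lookup_add mpoly_const_add ring_distribs sum.distrib)
  have trunc_scale: "trunc (mpoly_const c * p) = mpoly_const c * trunc p" for c p
    by (simp add: trunc_def lookup_const_mult mpoly_const_mult sum_distrib_left mult.assoc)
  have trunc_high: "trunc p = 0" if p: "p \<in> high n D" for p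
    unfolding trunc_def
  proof (rule sum.neutral, rule ballI)
    fix m assume "m \<in> L"
    then have "Poly_Mapping.lookup p m = 0"
      using p L(2,3)[of m] by (auto simp: high_def in_keys_iff not_le)
    then show "mpoly_const (Poly_Mapping.lookup p m) * monomial m = 0" by simp
  qed
  have trunc_monomial: "trunc (monomial m) = monomial m" if "m \<in> L" for m
  proof -
    have "trunc (monomial m) = (\<Sum>k\<in>L. if k = m then monomial m else 0)"
      unfolding trunc_def
      by (intro sum.cong refl) (auto simp: lookup_single when_def mpoly_const_mult_monomial)
    then show ?thesis using L(1) that by simp
  qed
  have "trunc p \<in> vs.span (trunc ` T)" for p
    using T(2)[of p]
  proof (induction rule: vs.span_induct_alt)
    case base
    then show ?case using trunc_scale[of 0 0] by (simp add: vs.span_zero)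
  next
    case (step c x y)
    then have "trunc x \<in> vs.span (trunc ` T)"
      by (auto simp: trunc_high vs.span_zero intro: vs.span_base)
    with step show ?case
      by (simp add: trunc_add trunc_scale vs.span_add vs.span_scale)
  qed
  then have "monomial ` L \<subseteq> vs.span (trunc ` T)"
    using trunc_monomial by (metis image_subsetI)
  moreover have inj: "inj_on (monomial :: _ \<Rightarrow> 'a mpoly) L"
  proof (rule inj_onI)
    fix a b assume "monomial a = (monomial b :: 'a mpoly)"
    then have "Poly_Mapping.keys (monomial a :: 'a mpoly) = Poly_Mapping.keys (monomial b :: 'a mpoly)"
      by simp
    then show "a = b" by simp
  qed
  moreover have "vs.independent (monomial ` L :: 'a mpoly set)"
  proof (rule vs.independent_if_scalars_zero)
    fix f :: "'a mpoly \<Rightarrow> 'a" and x :: "'a mpoly"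
    assume eq: "(\<Sum>x\<in>monomial ` L. mpoly_const (f x) * x) = 0" and "x \<in> monomial ` L"
    then obtain m where m: "m \<in> L" "x = monomial m" by blast
    have "(\<Sum>k\<in>L. mpoly_const (f (monomial k)) * monomial k) = 0"
      using eq unfolding sum.reindex[OF inj] by simp
    then have "(\<Sum>k\<in>L. Poly_Mapping.lookup (Poly_Mapping.single k (f (monomial k))) m) = 0"
      unfolding mpoly_const_mult_monomial by (metis lookup_sum lookup_zero)
    moreover have "(\<Sum>k\<in>L. Poly_Mapping.lookup (Poly_Mapping.single k (f (monomial k))) m) =
        (\<Sum>k\<in>L. if k = m then f (monomial m) else 0)"
      by (intro sum.cong refl) (auto simp: lookup_single when_def)
    ultimately show "f x = 0" using L(1) m by simp
  qed (use L(1) in simp)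
  ultimately have "card (monomial ` L :: 'a mpoly set) \<le> card (trunc ` T)"
    using vs.independent_span_bound T(1) by blast
  also have "\<dots> \<le> card T" by (rule card_image_le[OF T(1)])
  finally show ?thesis by (simp add: card_image[OF inj])
qed

section \<open>Counting monomials and comparing growth rates\<close>

lemma ex_low_monomials:
  assumes "0 < n" "0 < E"
  obtains L where "finite L" "card L = E ^ n"
    "\<And>m. m \<in> L \<Longrightarrow> Poly_Mapping.keys m \<subseteq> {1..n}" "\<And>m. m \<in> L \<Longrightarrow> mdeg m < n * E"
proof
  \<comment> \<open>The monomials with exponents in the box {0, ..., E - 1}^n. Each exponent is
    strictly below \<open>E\<close> and \<open>n\<close> is positive, so the total degree is
    strictly below \<open>n * E\<close>.\<close>
  let ?f = "\<lambda>\<gamma>. \<Sum>i\<in>{1..n}. Poly_Mapping.single i (\<gamma> i :: nat)"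
  let ?P = "{1..n} \<rightarrow>\<^sub>E {..<E}"
  have lookup: "Poly_Mapping.lookup (?f \<gamma>) k = (if k \<in> {1..n} then \<gamma> k else 0)" for \<gamma> k
    by (simp add: lookup_sum lookup_single when_def)
  have inj: "inj_on ?f ?P"
  proof (rule inj_onI)
    fix \<gamma> \<delta> assume *: "\<gamma> \<in> ?P" "\<delta> \<in> ?P" "?f \<gamma> = ?f \<delta>"
    then have "Poly_Mapping.lookup (?f \<gamma>) k = Poly_Mapping.lookup (?f \<delta>) k" for k by simp
    then have "\<gamma> k = \<delta> k" if "k \<in> {1..n}" for k
      unfolding lookup using that by presburger
    then show "\<gamma> = \<delta>" using *(1,2) by (intro PiE_ext) auto
  qed
  show "finite (?f ` ?P)" by (simp add: finite_PiE)
  show "card (?f ` ?P) = E ^ n" unfolding card_image[OF inj] by (simp add: card_PiE)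
  fix m assume "m \<in> ?f ` ?P"
  then obtain \<gamma> where m: "m = ?f \<gamma>" "\<gamma> \<in> ?P" by blast
  show keys: "Poly_Mapping.keys m \<subseteq> {1..n}"
  proof
    fix k assume "k \<in> Poly_Mapping.keys m"
    then show "k \<in> {1..n}" unfolding m(1) in_keys_iff lookup by presburger
  qed
  have "mdeg m = (\<Sum>i\<in>{1..n}. Poly_Mapping.lookup m i)"
    by (rule mdeg_superset[OF finite_atLeastAtMost keys])
  also have "\<dots> = (\<Sum>i\<in>{1..n}. \<gamma> i)"
    unfolding m(1) lookup by simp
  also have "\<dots> < (\<Sum>i\<in>{1..n}. E)"
    using m(2) assms by (intro sum_strict_mono) auto
  finally show "mdeg m < n * E" by simp
qed

lemma exponent_le_if_power_bound:
  fixes n N C K :: nat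
  assumes "\<And>E. 0 < E \<Longrightarrow> E ^ n \<le> C * (K * E) ^ N"
  shows "n \<le> N"
proof (rule ccontr)
  assume "\<not> n \<le> N"
  \<comment> \<open>If N < n, the hypothesis would give E^(N+1) <= E^n <= C K^N E^N, hence E <= C
    K^N. This \<open>E\<close> is just too large.\<close>
  define E where "E = Suc (C * K ^ N)"
  have "0 < E" by (simp add: E_def)
  have "E ^ N * E \<le> E ^ n"
    using \<open>\<not> n \<le> N\<close> power_increasing[of "Suc N" n E] by (simp add: E_def mult.commute)
  also have "\<dots> \<le> E ^ N * (C * K ^ N)"
    using assms[of E] \<open>0 < E\<close> by (simp add: power_mult_distrib mult_ac)
  finally have "E \<le> C * K ^ N" using \<open>0 < E\<close> by simp
  then show False by (simp add: E_def)
qed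

text \<open>Stands in for the dimension bound on the common zeros of \<open>F\<close>. As
  \<open>E\<close> grows, E^n independent monomials face a spanning set of size O(E^(card F + d -
  1)), so the exponents compare.\<close>

lemma num_vars_le_num_generators:
  fixes F :: "'a::field mpoly set"
  assumes d: "2 \<le> d" and F: "finite F" "\<And>f. f \<in> F \<Longrightarrow> const_coeff f = 0"
    and esym: "\<And>j. j \<in> {1..n} \<Longrightarrow>
      \<exists>r. deg_le (d - 2) r \<and> esym ({1..n} - {j}) (d - 1) - r \<in> ideal.span F"
  shows "n \<le> card F + (d - 1)"
proof (cases "n = 0")
  case False
  have "E ^ n \<le> (d - 1) ^ n * (Suc n * E) ^ (card F + (d - 1))" if E: "0 < E" for E
  proof -
    define D where "D = n * E"
    define J where "J = ideal.span (F \<union> high n D)"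
    have high_J: "high n D \<subseteq> J" and F_J: "ideal.span F \<subseteq> J"
      unfolding J_def using ideal.span_superset[of "F \<union> high n D"]
      by (auto intro: ideal.span_mono[THEN subsetD, rotated])
    have gen: "p \<in> vs.span (reps n d D \<union> J)" for p
    proof (rule in_vs_span_if_monomials)
      fix m
      show "monomial m \<in> vs.span (reps n d D \<union> J)"
      \<comment> \<open>Monomials of degree above \<open>D\<close> already lie in
        \<open>high n D\<close>, so the reduction is needed only up to degree \<open>D\<close>. This
        bounds the exponents of the e_l by \<open>D\<close>.\<close>
      proof (cases "mdeg m \<le> D")
        case True
        have "ideal.subspace J" unfolding J_def by (rule ideal.subspace_span)
        then show ?thesis
        proof (rule mpoly_in_span_reps[OF d])
          show "monomial k \<in> J" if "\<not> Poly_Mapping.keys k \<subseteq> {1..n}" for k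
            by (rule subsetD[OF high_J]) (use that in \<open>simp add: high_def\<close>)
        qed (use esym F_J True in \<open>auto intro: deg_le_single\<close>)
      next
        case False
        then have "monomial m \<in> high n D" by (simp add: high_def)
        with high_J show ?thesis by (auto intro: vs.span_base)
      qed
    qed
    have "F \<subseteq> high n 1" using F(2) high_1 by blast
    then have span: "p \<in> vs.span (ideal_reps n d D F D \<union> high n D)" for p
      using mpoly_in_span_ideal_reps[OF F(1), of n d D D p] gen unfolding J_def by simp
    obtain L where "finite L" "card L = E ^ n"
      "\<And>m. m \<in> L \<Longrightarrow> Poly_Mapping.keys m \<subseteq> {1..n}" "\<And>m. m \<in> L \<Longrightarrow> mdeg m < D"
      using ex_low_monomials[of n E] False E unfolding D_def by blast
    then have "E ^ n \<le> card (ideal_reps n d D F D)"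
      using card_low_monomials_le[OF card_ideal_reps(1)[OF F(1)] span, of L] by simp
    also have "\<dots> \<le> D ^ card F * ((d - 1) ^ n * Suc D ^ (d - 1))"
      by (rule card_ideal_reps(2)[OF F(1)])
    \<comment> \<open>Both \<open>D\<close> and \<open>Suc D\<close> are at most
      \<open>Suc n * E\<close>, since \<open>E\<close> is positive. The constants
      \<open>(d - 1) ^ n\<close> and \<open>Suc n\<close> are independent of
      \<open>E\<close>.\<close>
    also have "\<dots> \<le> (Suc n * E) ^ card F * ((d - 1) ^ n * (Suc n * E) ^ (d - 1))"
      using E by (intro mult_mono power_mono) (auto simp: D_def)
    finally show ?thesis by (simp only: power_add mult_ac)
  qed
  then show ?thesis by (rule exponent_le_if_power_bound)
qed simp

section \<open>The lower bound\<close>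

text \<open>The cut gives e_d - R as the sum of h_a * a. By the Leibniz rule each derivative of g_a
  * a lies in the ideal of a and g_a, so the derivatives of e_d agree modulo that ideal with those
  of a polynomial of degree at most d - 1.\<close>

lemma ex_common_zero_generators:
  fixes \<phi> :: "'a::comm_ring_1 formula"
  assumes d: "2 \<le> d" and \<phi>: "computed_poly \<phi> = elem_sym n d"
  obtains F where "finite F" "\<And>f. f \<in> F \<Longrightarrow> const_coeff f = 0"
    "\<And>j. j \<in> {1..n} \<Longrightarrow>
      \<exists>r. deg_le (d - 2) r \<and> esym ({1..n} - {j}) (d - 1) - r \<in> ideal.span (F :: 'a mpoly set)"
    "card F * d \<le> 4 * formula_size \<phi>"
proof -
  \<comment> \<open>Half of \<open>d\<close>, rounded up: small enough that a cut product has degree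
    at most d - 1, large enough that each generator costs at least d/2 leaves.\<close>
  define t where "t = (d + 1) div 2"
  have t: "0 < t" "2 * t \<le> d + 1" "d \<le> 2 * t" "t \<le> d" using d by (auto simp: t_def)
  have "split_poly d t (formula_size \<phi>) (esym {1..n} d :: 'a mpoly)"
    using split_poly_computed[OF t(1,2) d, of \<phi>] by (simp only: \<phi> elem_sym_eq_esym)
  then obtain A R r where A: "finite A" "\<forall>a\<in>A. deg_le (d - 1) a \<and> const_coeff a = 0"
     and R: "esym {1..n} d - R \<in> ideal.span A" "deg_le r (R :: 'a mpoly)" "r < t"
     and card: "card A * t + r \<le> formula_size \<phi>"
    unfolding split_poly_def by blast
  obtain h where h: "esym {1..n} d - R = (\<Sum>a\<in>A. h a * a)"
    using R(1) unfolding ideal.span_finite[OF A(1)] by blast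
  \<comment> \<open>The cofactors must vanish at the origin too. Their constant terms move into
    \<open>R'\<close>, whose degree stays at most d - 1 because every \<open>a\<close> has degree at
    most d - 1.\<close>
  define g where "g a = h a - mpoly_const (const_coeff (h a))" for a
  define R' where "R' = R + (\<Sum>a\<in>A. mpoly_const (const_coeff (h a)) * a)"
  define F where "F = A \<union> g ` A"
  have eq: "esym {1..n} d = R' + (\<Sum>a\<in>A. g a * a)"
  proof -
    have "(\<Sum>a\<in>A. g a * a) = (esym {1..n} d - R) - (\<Sum>a\<in>A. mpoly_const (const_coeff (h a)) * a)"
      unfolding h by (simp add: g_def left_diff_distrib sum_subtractf)
    then show ?thesis by (simp add: R'_def)
  qed
  have deg_R': "deg_le (d - 1) R'"
    unfolding R'_def
  proof (intro deg_le_add deg_le_sum)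
    show "deg_le (d - 1) R" using R(2,3) t by (auto intro: deg_le_trans)
    show "deg_le (d - 1) (mpoly_const (const_coeff (h a)) * a)" if "a \<in> A" for a
      using deg_le_mult[of 0 "mpoly_const (const_coeff (h a))" "d - 1" a] A(2) that by simp
  qed
  show ?thesis
  proof
    show "finite F" using A(1) by (simp add: F_def)
    show "const_coeff f = 0" if "f \<in> F" for f
      using that A(2) by (auto simp: F_def g_def)
    \<comment> \<open>One factor 2 comes from the pairs a, g_a, the other from d <= 2t.\<close>
    have "card F \<le> 2 * card A"
      using card_Un_le[of A "g ` A"] card_image_le[OF A(1), of g] by (simp add: F_def)
    then have "card F * d \<le> (2 * card A) * (2 * t)" using t(3) by (rule mult_le_mono)
    then show "card F * d \<le> 4 * formula_size \<phi>" using card by simp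
    fix j assume j: "j \<in> {1..n}"
    have "pder j (esym {1..n} d) - pder j R' = (\<Sum>a\<in>A. pder j (g a) * a + pder j a * g a)"
      unfolding eq by (simp add: pder_add pder_sum pder_mult mult.commute add.commute)
    also have "\<dots> \<in> ideal.span F"
      by (intro ideal.span_sum ideal.span_add ideal.span_scale ideal.span_base) (auto simp: F_def)
    finally have "esym ({1..n} - {j}) (d - 1) - pder j R' \<in> ideal.span F"
      using pder_esym[of "{1..n}" j "d - 1", where 'a = 'a] j d by simp
    moreover have "deg_le (d - 2) (pder j R')"
      using deg_le_pder[OF deg_R', of j] by (simp add: numeral_2_eq_2)
    ultimately show "\<exists>r. deg_le (d - 2) r \<and> esym ({1..n} - {j}) (d - 1) - r \<in> ideal.span F"
      by blast
  qed
qed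

section \<open>The case d = 1 and the conclusion\<close>

lemma pder_computed_poly: "j \<notin> formula_vars \<phi> \<Longrightarrow> pder j (computed_poly \<phi>) = 0"
proof (induction \<phi>)
  case (Plus fs)
  then show ?case by (induction fs) (auto simp: pder_add)
next
  case (Times fs)
  then show ?case by (induction fs) (auto simp: pder_mult)
qed (auto simp: pder_var)

lemma card_formula_vars: "finite (formula_vars \<phi>) \<and> card (formula_vars \<phi>) \<le> formula_size \<phi>"
proof (induction \<phi>)
  case (Plus fs)
  then show ?case
    by (induction fs) (auto intro: order_trans[OF card_Un_le] add_mono)
next
  case (Times fs)
  then show ?case
    by (induction fs) (auto intro: order_trans[OF card_Un_le] add_mono)
qed auto

text \<open>The cut requires \<open>2 \<le> d\<close>, so degree 1 is separate. The derivative of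
  e_1 in each x_j is 1, which is nonzero in every characteristic, so each variable labels a
  leaf.\<close>

lemma num_vars_le_formula_size:
  fixes \<phi> :: "'a::comm_ring_1 formula"
  assumes "computed_poly \<phi> = elem_sym n 1"
  shows "n \<le> formula_size \<phi>"
proof -
  have "j \<in> formula_vars \<phi>" if "j \<in> {1..n}" for j
  proof (rule ccontr)
    assume "j \<notin> formula_vars \<phi>"
    then have "pder j (esym {1..n} (Suc 0) :: 'a mpoly) = 0"
      using pder_computed_poly[of j \<phi>] assms by (simp add: elem_sym_eq_esym)
    with that show False
      using pder_esym[of "{1..n}" j 0, where 'a = 'a] by (simp add: esym_0)
  qed
  then have "card {1..n} \<le> card (formula_vars \<phi>)"
    using card_formula_vars[of \<phi>] by (intro card_mono) auto
  then show ?thesis using card_formula_vars[of \<phi>] by simp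
qed

theorem theorem1p1:
  fixes \<phi> :: "'a::field formula" and n d :: nat
  assumes "1 \<le> d" and "d \<le> n"
    and "formula_vars \<phi> \<subseteq> {1..n}"
    and "computed_poly \<phi> = elem_sym n d"
  shows "bound_const > 0 \<and> real (formula_size \<phi>) \<ge> bound_const * real d * (real n - real d)"
proof -
  \<comment> \<open>This is the bound with constant 1/4, stronger than \<open>bound_const\<close>
    demands.\<close>
  have "d * (n - d) \<le> 4 * formula_size \<phi>"
  proof (cases "d = 1")
    case True
    with assms(4) show ?thesis using num_vars_le_formula_size[of \<phi> n] by simp
  next
    case False
    then have d: "2 \<le> d" using assms(1) by simp
    obtain F :: "'a mpoly set" where F: "finite F" "\<And>f. f \<in> F \<Longrightarrow> const_coeff f = 0"
      "\<And>j. j \<in> {1..n} \<Longrightarrow>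
        \<exists>r. deg_le (d - 2) r \<and> esym ({1..n} - {j}) (d - 1) - r \<in> ideal.span F"
      and card: "card F * d \<le> 4 * formula_size \<phi>"
      using ex_common_zero_generators[OF d assms(4)] by metis
    have "n \<le> card F + (d - 1)" by (rule num_vars_le_num_generators[OF d F])
    then have "d * (n - d) \<le> d * card F" by (intro mult_le_mono2) linarith
    also have "\<dots> \<le> 4 * formula_size \<phi>" using card by (simp only: mult.commute)
    finally show ?thesis .
  qed
  then have "real (d * (n - d)) \<le> real (4 * formula_size \<phi>)" by (rule of_nat_mono)
  then have "real d * (real n - real d) \<le> 4 * real (formula_size \<phi>)"
    using assms(2) by (simp add: of_nat_diff)
  then show ?thesis by (simp add: bound_const_def)
qed

end
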